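(* Let $N\in\mathbb N$, let $\hat\rho_0\in\mathrm{Herm}(N)$ be positive semidefinite of full rank, and let $\hat\rho$ be in the essential domain of $\widehat{\mathrm{QKL}}(\cdot,\hat\rho_0)$. Then the subdifferential is $$\partial\big(\widehat{\mathrm{QKL}}(\cdot,\hat\rho_0)\big)(\hat\rho)=\begin{cases}\{\ln\hat\rho-\ln\hat\rho_0\}&\text{if }\ker\hat\rho=\{0\},\\ \emptyset&\text{else.}\end{cases}$$
   Context: $\mathrm{Herm}(N)$ is the real vector space of Hermitian $N\times N$ complex matrices with inner product $\langle\hat\sigma,\hat\rho\rangle=\operatorname{tr}(\hat\sigma\hat\rho)$; subdifferentials are taken with respect to this inner product. The quantum relative entropy $\widehat{\mathrm{QKL}}(\hat\rho,\hat\rho_0)$ (with $\hat\rho_0$ positive definite) equals $\operatorname{tr}(\hat\rho_0-\hat\rho+\hat\rho\ln\hat\rho-\hat\rho\ln\hat\rho_0)$ if $\hat\rho$ is positive semidefinite (with $0\ln0=0$ in the spectral calculus), and $+\infty$ otherwise. The essential domain is the set of points where the functional is finite. *)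

theory Defs
  imports
    "HOL-Library.Extended_Real"
    "Jordan_Normal_Form.Schur_Decomposition"
    "Jordan_Normal_Form.Matrix_Kernel"
    "Jordan_Normal_Form.DL_Rank"
begin

definition Herm :: "nat \<Rightarrow> complex mat set" where
  "Herm N = {A \<in> carrier_mat N N. mat_adjoint A = A}"

definition mat_trace :: "complex mat \<Rightarrow> complex" where
  "mat_trace A = (\<Sum>i<dim_row A. A $$ (i, i))"

text \<open>For Hermitian \<open>A\<close> and \<open>B\<close> of the same size, the trace of \<open>A * B\<close> is real, so that taking
  the real part only converts it to type \<^typ>\<open>real\<close>.\<close>

definition herm_inner :: "complex mat \<Rightarrow> complex mat \<Rightarrow> real" where
  "herm_inner A B = Re (mat_trace (A * B))"

text \<open>The quadratic form of a Hermitian matrix is real-valued.\<close>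

definition pos_semidef :: "complex mat \<Rightarrow> bool" where
  "pos_semidef A \<longleftrightarrow> A \<in> Herm (dim_row A) \<and>
     (\<forall>v \<in> carrier_vec (dim_row A). 0 \<le> Re ((A *\<^sub>v v) \<bullet>c v))"

definition unitary_mat :: "nat \<Rightarrow> complex mat \<Rightarrow> bool" where
  "unitary_mat N U \<longleftrightarrow> U \<in> carrier_mat N N \<and>
     mat_adjoint U * U = 1\<^sub>m N \<and> U * mat_adjoint U = 1\<^sub>m N"

text \<open>The spectral calculus: \<open>f(A) = U diag(f(d\<^sub>0), \<dots>) U\<^sup>*\<close> for any unitary diagonalization
  \<open>A = U diag(d\<^sub>0, \<dots>) U\<^sup>*\<close> with real \<open>d\<^sub>i\<close>. Such a diagonalization exists for every Hermitian
  \<open>A\<close>, and the result does not depend on it. Nothing is intended for other matrices.\<close>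

definition spectral_apply :: "(real \<Rightarrow> real) \<Rightarrow> complex mat \<Rightarrow> complex mat" where
  "spectral_apply f A = (THE B. \<exists>U d. unitary_mat (dim_row A) U \<and>
     A = U * mat_diag (dim_row A) (\<lambda>i. complex_of_real (d i)) * mat_adjoint U \<and>
     B = U * mat_diag (dim_row A) (\<lambda>i. complex_of_real (f (d i))) * mat_adjoint U)"

text \<open>Only meaningful for positive definite matrices.\<close>

definition mat_ln :: "complex mat \<Rightarrow> complex mat" where
  "mat_ln = spectral_apply ln"

text \<open>\<open>A ln A\<close> for positive semidefinite \<open>A\<close>, with \<open>0 ln 0 = 0\<close>.\<close>

definition mat_xlnx :: "complex mat \<Rightarrow> complex mat" where
  "mat_xlnx = spectral_apply (\<lambda>x. if x = 0 then 0 else x * ln x)"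

text \<open>The trace below is that of a sum of Hermitian matrices and a product of two Hermitian
  matrices, hence real.\<close>

definition QKL :: "complex mat \<Rightarrow> complex mat \<Rightarrow> ereal" where
  "QKL \<rho> \<rho>\<^sub>0 =
     (if pos_semidef \<rho>
      then ereal (Re (mat_trace (\<rho>\<^sub>0 - \<rho> + mat_xlnx \<rho> - \<rho> * mat_ln \<rho>\<^sub>0)))
      else \<infinity>)"

definition essential_domain :: "'a set \<Rightarrow> ('a \<Rightarrow> ereal) \<Rightarrow> 'a set" where
  "essential_domain V F = {x \<in> V. \<bar>F x\<bar> \<noteq> \<infinity>}"

text \<open>Here \<open>V\<close> is the carrier of a real inner product space with inner product \<open>ip\<close>.\<close>

definition subdifferential ::
    "'a::minus set \<Rightarrow> ('a \<Rightarrow> 'a \<Rightarrow> real) \<Rightarrow> ('a \<Rightarrow> ereal) \<Rightarrow> 'a \<Rightarrow> 'a set" where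
  "subdifferential V ip F x = {s \<in> V. \<forall>y \<in> V. F x + ereal (ip s (y - x)) \<le> F y}"

end

theory Submission
  imports Defs "Jordan_Normal_Form.Spectral_Radius"
begin

text \<open>With \<open>K = s + ln \<rho>\<^sub>0\<close>, a Hermitian \<open>s\<close> is a subgradient at \<open>\<rho>\<close> iff \<open>\<rho>\<close> minimizes the free energy
  \<open>F(\<sigma>) = tr (\<sigma> ln \<sigma> - \<sigma> - K \<sigma>)\<close> over the positive semidefinite matrices. By Klein's inequality,
  which after diagonalization reduces to \<open>ln x \<le> x - 1\<close>, the positive definite matrix \<open>exp K\<close> is the
  unique minimizer. So \<open>s\<close> is a subgradient iff \<open>exp (s + ln \<rho>\<^sub>0) = \<rho>\<close>, which forces \<open>\<rho>\<close> to be
  invertible and \<open>s = ln \<rho> - ln \<rho>\<^sub>0\<close>; neither derivatives nor limits are needed.\<close>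

section \<open>Entries of products and adjoints; Hermitian matrices\<close>

lemma index_mult_mat_sum:
  assumes "A \<in> carrier_mat m n" "B \<in> carrier_mat n p" "i < m" "j < p"
  shows "(A * B) $$ (i, j) = (\<Sum>k<n. A $$ (i, k) * B $$ (k, j))"
  using assms by (auto simp: scalar_prod_def atLeast0LessThan intro!: sum.cong)

lemma dim_mat_adjoint [simp]:
  "dim_row (mat_adjoint A) = dim_col A" "dim_col (mat_adjoint A) = dim_row A"
  by (auto simp: mat_adjoint_def)

lemma mat_adjoint_carrier [simp]: "A \<in> carrier_mat m n \<Longrightarrow> mat_adjoint A \<in> carrier_mat n m"
  by auto

lemma index_mat_adjoint [simp]:
  fixes A :: "complex mat"
  shows "i < dim_col A \<Longrightarrow> j < dim_row A \<Longrightarrow> mat_adjoint A $$ (i, j) = cnj (A $$ (j, i))"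
  by (simp add: mat_adjoint_def mat_of_rows_def)

lemma mat_adjoint_mult:
  fixes A B :: "complex mat"
  assumes "A \<in> carrier_mat m n" "B \<in> carrier_mat n p"
  shows "mat_adjoint (A * B) = mat_adjoint B * mat_adjoint A"
proof (rule eq_matI)
  fix i j assume "i < dim_row (mat_adjoint B * mat_adjoint A)" "j < dim_col (mat_adjoint B * mat_adjoint A)"
  then have ij: "i < p" "j < m" using assms by auto
  have "mat_adjoint (A * B) $$ (i, j) = cnj ((A * B) $$ (j, i))"
    using assms ij by (intro index_mat_adjoint) auto
  also have "\<dots> = (\<Sum>k<n. cnj (A $$ (j, k)) * cnj (B $$ (k, i)))"
    using index_mult_mat_sum[OF assms ij(2,1)] by simp
  also have "\<dots> = (\<Sum>k<n. mat_adjoint B $$ (i, k) * mat_adjoint A $$ (k, j))"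
    using assms ij by (intro sum.cong) auto
  also have "\<dots> = (mat_adjoint B * mat_adjoint A) $$ (i, j)"
    using assms ij by (subst index_mult_mat_sum[of _ p n _ m]) auto
  finally show "mat_adjoint (A * B) $$ (i, j) = (mat_adjoint B * mat_adjoint A) $$ (i, j)" .
qed (use assms in auto)

lemma HermD:
  assumes "A \<in> Herm N"
  shows "A \<in> carrier_mat N N" "mat_adjoint A = A"
  using assms by (auto simp: Herm_def)

lemma Herm_iff_index:
  assumes A: "A \<in> carrier_mat N N"
  shows "A \<in> Herm N \<longleftrightarrow> (\<forall>i<N. \<forall>j<N. cnj (A $$ (j, i)) = A $$ (i, j))"
proof
  assume "A \<in> Herm N"
  then show "\<forall>i<N. \<forall>j<N. cnj (A $$ (j, i)) = A $$ (i, j)"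
    using index_mat_adjoint[of _ A] by (metis HermD carrier_matD)
next
  assume "\<forall>i<N. \<forall>j<N. cnj (A $$ (j, i)) = A $$ (i, j)"
  then have "mat_adjoint A = A" using A by (intro eq_matI) auto
  then show "A \<in> Herm N" using A by (simp add: Herm_def)
qed

lemma Herm_add: "A \<in> Herm N \<Longrightarrow> B \<in> Herm N \<Longrightarrow> A + B \<in> Herm N"
  using HermD[of A N] HermD[of B N] Herm_iff_index[of A N] Herm_iff_index[of B N]
  by (subst Herm_iff_index) auto

lemma Herm_minus: "A \<in> Herm N \<Longrightarrow> B \<in> Herm N \<Longrightarrow> A - B \<in> Herm N"
  using HermD[of A N] HermD[of B N] Herm_iff_index[of A N] Herm_iff_index[of B N]
  by (subst Herm_iff_index) auto

section \<open>Unitary matrices\<close>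

lemma unitary_matD:
  assumes "unitary_mat N U"
  shows "U \<in> carrier_mat N N" "mat_adjoint U \<in> carrier_mat N N"
    "mat_adjoint U * U = 1\<^sub>m N" "U * mat_adjoint U = 1\<^sub>m N"
  using assms by (auto simp: unitary_mat_def)

text \<open>Orthonormal columns suffice, because a one-sided inverse of a square matrix is
  two-sided.\<close>

lemma unitary_matI:
  assumes U: "U \<in> carrier_mat N N"
    and orth: "\<And>i j. i < N \<Longrightarrow> j < N \<Longrightarrow>
      (\<Sum>k<N. cnj (U $$ (k, i)) * U $$ (k, j)) = (if i = j then 1 else 0)"
  shows "unitary_mat N U"
proof -
  have "mat_adjoint U * U = 1\<^sub>m N"
  proof (rule eq_matI)
    fix i j assume "i < dim_row (1\<^sub>m N :: complex mat)" "j < dim_col (1\<^sub>m N :: complex mat)"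
    then have ij: "i < N" "j < N" by auto
    show "(mat_adjoint U * U) $$ (i, j) = 1\<^sub>m N $$ (i, j)"
      using U ij orth[OF ij] by (subst index_mult_mat_sum[of _ N N _ N]) auto
  qed (use U in auto)
  then show ?thesis
    using U mat_mult_left_right_inverse[of "mat_adjoint U" N U] by (simp add: unitary_mat_def)
qed

lemma unitary_mat_mult:
  assumes U: "unitary_mat N U" and V: "unitary_mat N V"
  shows "unitary_mat N (U * V)"
proof -
  note u = unitary_matD[OF U] and v = unitary_matD[OF V]
  have "mat_adjoint (U * V) * (U * V) = mat_adjoint V * mat_adjoint U * (U * V)"
    using mat_adjoint_mult[of U N N V N] u v by simp
  also have "\<dots> = mat_adjoint V * (mat_adjoint U * U * V)"
    using assoc_mult_mat[OF v(2) u(2), of "U * V" N] assoc_mult_mat[OF u(2) u(1) v(1)] u v by simp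
  also have "\<dots> = 1\<^sub>m N" using u v by simp
  finally have "mat_adjoint (U * V) * (U * V) = 1\<^sub>m N" .
  moreover have "U * V \<in> carrier_mat N N" using u v by simp
  ultimately show ?thesis
    using mat_mult_left_right_inverse[of "mat_adjoint (U * V)" N "U * V"]
    by (simp add: unitary_mat_def)
qed

lemma unitary_mat_adjoint:
  assumes "unitary_mat N U" shows "unitary_mat N (mat_adjoint U)"
proof -
  have "mat_adjoint (mat_adjoint U) = U" by (rule eq_matI) auto
  then show ?thesis using assms by (auto simp: unitary_mat_def)
qed

section \<open>Matrices with a given eigenbasis and real spectrum\<close>

text \<open>The term has the shape occurring in \<open>spectral_apply\<close>, so that the latter
  can be folded into statements about \<open>diag_conj\<close>.\<close>

definition diag_conj :: "nat \<Rightarrow> complex mat \<Rightarrow> (nat \<Rightarrow> real) \<Rightarrow> complex mat" where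
  "diag_conj N U d = U * mat_diag N (\<lambda>i. complex_of_real (d i)) * mat_adjoint U"

lemma diag_conj_carrier [simp]: "U \<in> carrier_mat N N \<Longrightarrow> diag_conj N U d \<in> carrier_mat N N"
  unfolding diag_conj_def by (meson mat_adjoint_carrier mat_diag_dim mult_carrier_mat)

lemma index_diag_conj:
  assumes U: "U \<in> carrier_mat N N" and ij: "i < N" "j < N"
  shows "diag_conj N U d $$ (i, j) = (\<Sum>k<N. U $$ (i, k) * of_real (d k) * cnj (U $$ (j, k)))"
proof -
  have "U * mat_diag N (\<lambda>i. complex_of_real (d i)) \<in> carrier_mat N N"
    using U by (meson mat_diag_dim mult_carrier_mat)
  then have "diag_conj N U d $$ (i, j) =
      (\<Sum>k<N. (U * mat_diag N (\<lambda>i. complex_of_real (d i))) $$ (i, k) * mat_adjoint U $$ (k, j))"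
    unfolding diag_conj_def using U ij by (intro index_mult_mat_sum) auto
  also have "\<dots> = (\<Sum>k<N. U $$ (i, k) * of_real (d k) * cnj (U $$ (j, k)))"
    using U ij by (intro sum.cong) (auto simp: mat_diag_mult_right[OF U])
  finally show ?thesis .
qed

lemma diag_conj_Herm: "U \<in> carrier_mat N N \<Longrightarrow> diag_conj N U d \<in> Herm N"
  by (subst Herm_iff_index) (auto simp: index_diag_conj mult_ac intro!: sum.cong)

lemma diag_conj_one: "unitary_mat N U \<Longrightarrow> diag_conj N U (\<lambda>_. 1) = 1\<^sub>m N"
  using unitary_matD[of N U] by (simp add: diag_conj_def)

text \<open>Change of basis: it carries a diagonalization found in the basis \<open>U\<close> back
  to the original one, and lets two eigenbases be compared through their overlap alone.\<close>

lemma diag_conj_mult: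
  assumes U: "unitary_mat N U" and V: "V \<in> carrier_mat N N"
  shows "diag_conj N (U * V) d = U * diag_conj N V d * mat_adjoint U"
proof -
  note u = unitary_matD[OF U]
  define D where "D = mat_diag N (\<lambda>i. complex_of_real (d i))"
  have D: "D \<in> carrier_mat N N" by (simp add: D_def)
  have vd: "V * D \<in> carrier_mat N N" using V D by simp
  have *: "mat_adjoint V \<in> carrier_mat N N" using V by simp
  have "diag_conj N (U * V) d = U * V * D * (mat_adjoint V * mat_adjoint U)"
    using mat_adjoint_mult[of U N N V N] u V by (simp add: diag_conj_def D_def)
  also have "\<dots> = U * (V * D) * (mat_adjoint V * mat_adjoint U)"
    using u V D by (simp add: assoc_mult_mat[of U N N V N D N])
  also have "\<dots> = U * (V * D) * mat_adjoint V * mat_adjoint U"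
    using assoc_mult_mat[of "U * (V * D)" N N "mat_adjoint V" N "mat_adjoint U" N] u vd * by simp
  also have "U * (V * D) * mat_adjoint V = U * (V * D * mat_adjoint V)"
    using assoc_mult_mat[of U N N "V * D" N "mat_adjoint V" N] u vd * by simp
  finally show ?thesis by (simp add: diag_conj_def D_def)
qed

section \<open>The spectral theorem for Hermitian matrices\<close>

text \<open>Complete \<open>v\<close> to a basis, orthogonalize by Gram-Schmidt, which keeps the
  first vector, and normalize. The factor \<open>c\<close> stays unspecified, since only the
  direction of an eigenvector matters later.\<close>

lemma exists_unitary_first_col:
  assumes v: "v \<in> carrier_vec n" "v \<noteq> 0\<^sub>v n"
  shows "\<exists>W c. unitary_mat n W \<and> (\<forall>i<n. W $$ (i, 0) = c * v $ i)"
proof -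
  interpret cof_vec_space n "TYPE(complex)" .
  have n: "n > 0" using v by (cases n) auto
  define b where "b = basis_completion v"
  define ws where "ws = gram_schmidt n b"
  from basis_completion[OF v, folded b_def]
  have dist_b: "distinct b" and indep: "\<not> lin_dep (set b)" and b: "set b \<subseteq> carrier_vec n"
    and hdb: "hd b = v" and len_b: "length b = n" by auto
  from hdb len_b n obtain vs where bv: "b = v # vs" by (cases b, auto)
  from gram_schmidt_result[OF b dist_b indep refl, folded ws_def]
  have ws: "set ws \<subseteq> carrier_vec n" "corthogonal ws" "length ws = n"
    by (auto simp: len_b)
  have ws0: "ws ! 0 = v"
    using gram_schmidt_hd[OF v(1), of vs, folded bv] ws n unfolding ws_def
    by (metis hd_conv_nth length_0_conv less_not_refl)
  have wsi: "ws ! i \<in> carrier_vec n" if "i < n" for i using ws that by auto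
  \<comment> \<open>Squared norms: Gram-Schmidt delivers orthogonal vectors that are not yet
    normalized.\<close>
  define q where "q i = (\<Sum>k<n. (cmod (ws ! i $ k))\<^sup>2)" for i
  have ip: "(\<Sum>k<n. cnj (ws ! i $ k) * ws ! j $ k) = (if i = j then of_real (q i) else 0)"
    if "i < n" "j < n" for i j
  proof -
    have "ws ! j \<bullet>c ws ! i = (\<Sum>k<n. cnj (ws ! i $ k) * ws ! j $ k)"
      using wsi[OF that(1)] wsi[OF that(2)]
      by (auto simp: scalar_prod_def atLeast0LessThan mult.commute intro!: sum.cong)
    moreover have "i \<noteq> j \<Longrightarrow> ws ! j \<bullet>c ws ! i = 0"
      using corthogonalD[OF ws(2)] that ws(3) by auto
    moreover have "(\<Sum>k<n. cnj (ws ! i $ k) * ws ! i $ k) = of_real (q i)"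
      unfolding q_def of_real_sum
      by (rule sum.cong) (simp_all only: complex_norm_square mult.commute)
    ultimately show ?thesis by auto
  qed
  have q: "q i > 0" if "i < n" for i
  proof -
    have "ws ! i \<bullet>c ws ! i \<noteq> 0" using corthogonalD[OF ws(2)] that ws(3) by auto
    moreover have "ws ! i \<bullet>c ws ! i = (\<Sum>k<n. cnj (ws ! i $ k) * ws ! i $ k)"
      using wsi[OF that]
      by (auto simp: scalar_prod_def atLeast0LessThan mult.commute intro!: sum.cong)
    ultimately have "q i \<noteq> 0" using ip[OF that that] by auto
    moreover have "q i \<ge> 0" unfolding q_def by (rule sum_nonneg) auto
    ultimately show ?thesis by auto
  qed
  define W where "W = mat n n (\<lambda>(i, j). ws ! j $ i / of_real (sqrt (q j)))"
  have "unitary_mat n W"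
  proof (rule unitary_matI)
    fix i j assume ij: "i < n" "j < n"
    have "(\<Sum>k<n. cnj (W $$ (k, i)) * W $$ (k, j)) =
      (\<Sum>k<n. cnj (ws ! i $ k) * ws ! j $ k) / (of_real (sqrt (q i)) * of_real (sqrt (q j)))"
      using ij by (simp add: W_def sum_divide_distrib)
    also have "\<dots> = (if i = j then 1 else 0)"
      using ip[OF ij] q[OF ij(1)] by (auto simp flip: of_real_mult)
    finally show "(\<Sum>k<n. cnj (W $$ (k, i)) * W $$ (k, j)) = (if i = j then 1 else 0)" .
  qed (simp add: W_def)
  moreover have "\<forall>i<n. W $$ (i, 0) = (1 / of_real (sqrt (q 0))) * v $ i"
    using n ws0 by (simp add: W_def)
  ultimately show ?thesis by blast
qed

text \<open>Induction on the size by deflation: in a unitary basis starting with an eigenvector, the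
  first column vanishes below the diagonal, by symmetry so does the rest of the first row, and the
  remaining block is again Hermitian.\<close>

lemma Herm_diagonalize: "A \<in> Herm N \<Longrightarrow> \<exists>U d. unitary_mat N U \<and> A = diag_conj N U d"
proof (induction N arbitrary: A)
  case 0
  have "unitary_mat 0 (1\<^sub>m 0)" by (rule unitary_matI) auto
  moreover have "A = diag_conj 0 (1\<^sub>m 0) d" for d
    using HermD(1)[OF 0] by (intro eq_matI) (auto simp: diag_conj_def)
  ultimately show ?case by blast
next
  case (Suc n)
  let ?N = "Suc n"
  note A = HermD[OF Suc.prems]
  \<comment> \<open>A complex matrix of positive size has an eigenvalue; that \<open>e\<close> is
    real emerges only below.\<close>
  obtain e v where v: "v \<in> carrier_vec ?N" "v \<noteq> 0\<^sub>v ?N" and ev: "A *\<^sub>v v = e \<cdot>\<^sub>v v"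
    using spectrum_non_empty[OF A(1)] A(1)
    by (auto simp: spectrum_def eigenvalue_def eigenvector_def)
  obtain W c where W: "unitary_mat ?N W" and W0: "\<forall>i<?N. W $$ (i, 0) = c * v $ i"
    using exists_unitary_first_col[OF v] by blast
  note w = unitary_matD[OF W]
  \<comment> \<open>\<open>A\<close> expressed in the basis of the columns of
    \<open>W\<close>.\<close>
  define B where "B = mat_adjoint W * (A * W)"
  have AW: "A * W \<in> carrier_mat ?N ?N" using A w by simp
  have B: "B \<in> carrier_mat ?N ?N" unfolding B_def using AW w(2) by simp
  have A_eq: "A = W * B * mat_adjoint W"
  proof -
    have "W * B = W * mat_adjoint W * (A * W)"
      unfolding B_def using assoc_mult_mat[OF w(1) w(2) AW] by simp
    then have "W * B = A * W" by (simp only: w(4) left_mult_one_mat[OF AW])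
    then show ?thesis using assoc_mult_mat[OF A(1) w(1) w(2)] right_mult_one_mat[OF A(1)] w(4) by simp
  qed
  have "mat_adjoint (mat_adjoint W) = W" by (rule eq_matI) auto
  then have "mat_adjoint B = B"
    using mat_adjoint_mult[OF w(2) AW] mat_adjoint_mult[OF A(1) w(1)] A(2)
      assoc_mult_mat[OF w(2) A(1) w(1)] by (simp add: B_def)
  then have BH: "B \<in> Herm ?N" using B by (simp add: Herm_def)
  then have Bsym: "cnj (B $$ (j, i)) = B $$ (i, j)" if "i < ?N" "j < ?N" for i j
    using Herm_iff_index[OF B] that by blast
  \<comment> \<open>Column 0 of \<open>W\<close> is a multiple of the eigenvector, so
    \<open>A\<close> scales it by \<open>e\<close>, and orthonormality of the columns leaves only
    the top entry.\<close>
  have col0: "B $$ (i, 0) = (if i = 0 then e else 0)" if i: "i < ?N" for i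
  proof -
    have "(A * W) $$ (k, 0) = e * W $$ (k, 0)" if k: "k < ?N" for k
    proof -
      have "(A * W) $$ (k, 0) = (\<Sum>l<?N. A $$ (k, l) * W $$ (l, 0))"
        using index_mult_mat_sum[OF A(1) w(1) k] by simp
      also have "\<dots> = c * (\<Sum>l<?N. A $$ (k, l) * v $ l)"
        unfolding sum_distrib_left using W0 by (intro sum.cong) auto
      also have "(\<Sum>l<?N. A $$ (k, l) * v $ l) = (A *\<^sub>v v) $ k"
        using k A(1) v(1) by (auto simp: scalar_prod_def atLeast0LessThan intro!: sum.cong)
      also have "c * \<dots> = e * W $$ (k, 0)"
        using k W0 v(1) by (simp add: ev)
      finally show ?thesis .
    qed
    then have "B $$ (i, 0) = e * (\<Sum>k<?N. mat_adjoint W $$ (i, k) * W $$ (k, 0))"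
      unfolding B_def sum_distrib_left
      by (subst index_mult_mat_sum[OF w(2) AW i]) (auto intro!: sum.cong)
    also have "\<dots> = e * (mat_adjoint W * W) $$ (i, 0)"
      using index_mult_mat_sum[OF w(2) w(1) i, of 0] by simp
    finally show ?thesis using i by (simp add: w)
  qed
  have row0: "B $$ (0, i) = (if i = 0 then e else 0)" if i: "i < ?N" for i
    using col0[OF i] Bsym[of 0 i] Bsym[of 0 0] i col0[of 0] by (auto split: if_splits)
  \<comment> \<open>The eigenvalue is a diagonal entry of the Hermitian matrix \<open>B\<close>,
    hence real.\<close>
  have e: "of_real (Re e) = e"
    using Bsym[of 0 0] col0[of 0] by (auto simp: complex_eq_iff)
  define A' where "A' = mat n n (\<lambda>(i, j). B $$ (Suc i, Suc j))"
  have "A' \<in> Herm n" using Bsym by (subst Herm_iff_index) (auto simp: A'_def)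
  from Suc.IH[OF this] obtain U' d' where U': "unitary_mat n U'" and A': "A' = diag_conj n U' d'"
    by blast
  note u' = unitary_matD[OF U']
  have B': "B $$ (Suc i, Suc j) = (\<Sum>k<n. U' $$ (i, k) * of_real (d' k) * cnj (U' $$ (j, k)))"
    if "i < n" "j < n" for i j
    using arg_cong[OF A', of "\<lambda>M. M $$ (i, j)"] that index_diag_conj[OF u'(1) that]
    by (simp add: A'_def)
  have orth': "(\<Sum>k<n. cnj (U' $$ (k, i)) * U' $$ (k, j)) = (if i = j then 1 else 0)"
    if "i < n" "j < n" for i j
  proof -
    have "(\<Sum>k<n. cnj (U' $$ (k, i)) * U' $$ (k, j)) = (mat_adjoint U' * U') $$ (i, j)"
      using that u' by (subst index_mult_mat_sum[of _ n n _ n]) (auto intro!: sum.cong)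
    then show ?thesis using that by (simp add: u')
  qed
  \<comment> \<open>Block diagonal extension of \<open>U'\<close> by a leading 1; index 0 belongs to
    the eigenvalue split off, and all indices of \<open>U'\<close> shift by one.\<close>
  define P where "P = mat ?N ?N (\<lambda>(i, j). case i of 0 \<Rightarrow> if j = 0 then 1 else 0
    | Suc i' \<Rightarrow> (case j of 0 \<Rightarrow> 0 | Suc j' \<Rightarrow> U' $$ (i', j')))"
  have P: "P \<in> carrier_mat ?N ?N" by (simp add: P_def)
  have PU: "unitary_mat ?N P"
  proof (rule unitary_matI[OF P])
    fix i j assume ij: "i < ?N" "j < ?N"
    show "(\<Sum>k<?N. cnj (P $$ (k, i)) * P $$ (k, j)) = (if i = j then 1 else 0)"
      using ij orth' unfolding sum.lessThan_Suc_shift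
      by (cases i; cases j) (auto simp: P_def)
  qed
  define d where "d = case_nat (Re e) d'"
  have "B = diag_conj ?N P d"
  proof (rule eq_matI)
    fix i j assume "i < dim_row (diag_conj ?N P d)" "j < dim_col (diag_conj ?N P d)"
    then have ij: "i < ?N" "j < ?N" using diag_conj_carrier[OF P, of d] by auto
    show "B $$ (i, j) = diag_conj ?N P d $$ (i, j)"
      using ij col0 row0 B' unfolding index_diag_conj[OF P ij] sum.lessThan_Suc_shift
      by (cases i; cases j) (auto simp: P_def d_def e)
  qed (use B diag_conj_carrier[OF P, of d] in auto)
  then have "A = diag_conj ?N (W * P) d" using A_eq diag_conj_mult[OF W P] by simp
  then show ?case using unitary_mat_mult[OF W PU] by blast
qed

section \<open>Comparing diagonalizations; the spectral calculus\<close>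

lemma unitary_cancel:
  assumes "unitary_mat N U" "M \<in> carrier_mat N N"
  shows "U * (mat_adjoint U * M) = M" "mat_adjoint U * (U * M) = M"
  using unitary_matD[OF assms(1)] assms(2)
    assoc_mult_mat[of U N N "mat_adjoint U" N M N] assoc_mult_mat[of "mat_adjoint U" N N U N M N]
  by (auto simp: left_mult_one_mat)

text \<open>The eigenvector equations for all columns of \<open>U\<close> at once, and their adjoint
  form.\<close>

lemma diag_conj_intertwine:
  assumes U: "unitary_mat N U"
  shows "diag_conj N U d * U = U * mat_diag N (\<lambda>i. complex_of_real (d i))"
    "mat_adjoint U * diag_conj N U d = mat_diag N (\<lambda>i. complex_of_real (d i)) * mat_adjoint U"
proof -
  note u = unitary_matD[OF U]
  define D where "D = mat_diag N (\<lambda>i. complex_of_real (d i))"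
  have D: "D \<in> carrier_mat N N" by (simp add: D_def)
  have UD: "U * D \<in> carrier_mat N N" and DU: "D * mat_adjoint U \<in> carrier_mat N N"
    using u D by auto
  have "U * D * mat_adjoint U * U = U * D"
    using assoc_mult_mat[OF UD u(2) u(1)] right_mult_one_mat[OF UD] u(3) by simp
  then show "diag_conj N U d * U = U * mat_diag N (\<lambda>i. complex_of_real (d i))"
    by (simp add: diag_conj_def D_def)
  have "mat_adjoint U * (U * D * mat_adjoint U) = D * mat_adjoint U"
    using assoc_mult_mat[OF u(1) D u(2)] unitary_cancel(2)[OF U DU] by simp
  then show "mat_adjoint U * diag_conj N U d = mat_diag N (\<lambda>i. complex_of_real (d i)) * mat_adjoint U"
    by (simp add: diag_conj_def D_def)
qed

text \<open>Two diagonalizations describe the same matrix iff the overlap \<open>U\<^sup>* V\<close> of the eigenbases only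
  connects equal eigenvalues. This yields both the independence of the spectral calculus of the
  chosen diagonalization and the equality case of Klein's inequality.\<close>

lemma diag_conj_eq_iff:
  assumes U: "unitary_mat N U" and V: "unitary_mat N V"
  shows "diag_conj N U l = diag_conj N V m \<longleftrightarrow>
    (\<forall>i<N. \<forall>j<N. (mat_adjoint U * V) $$ (i, j) \<noteq> 0 \<longrightarrow> l i = m j)"
proof -
  note u = unitary_matD[OF U] and v = unitary_matD[OF V]
  define W where "W = mat_adjoint U * V"
  have WU: "unitary_mat N W"
    unfolding W_def using unitary_mat_mult[OF unitary_mat_adjoint[OF U] V] .
  note w = unitary_matD[OF WU]
  have V_eq: "V = U * W" unfolding W_def using unitary_cancel(1)[OF U v(1)] by simp
  define L M where "L = mat_diag N (\<lambda>i. complex_of_real (l i))"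
    and "M = mat_diag N (\<lambda>i. complex_of_real (m i))"
  have LM: "L \<in> carrier_mat N N" "M \<in> carrier_mat N N" by (simp_all add: L_def M_def)
  \<comment> \<open>Equality of the two matrices becomes an intertwining relation between diagonal
    matrices, which can be read off entry by entry.\<close>
  have "diag_conj N U l = diag_conj N V m \<longleftrightarrow> W * M = L * W"
  proof
    assume eq: "diag_conj N U l = diag_conj N V m"
    have "W * M = mat_adjoint U * (V * M)"
      unfolding W_def using assoc_mult_mat[OF u(2) v(1) LM(2)] .
    also have "\<dots> = mat_adjoint U * (diag_conj N U l * V)"
      using diag_conj_intertwine(1)[OF V, of m] by (simp add: eq M_def)
    also have "\<dots> = mat_adjoint U * diag_conj N U l * V"
      using assoc_mult_mat[OF u(2) diag_conj_carrier[OF u(1)] v(1)] by simp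
    also have "\<dots> = L * W"
      using diag_conj_intertwine(2)[OF U, of l] assoc_mult_mat[OF LM(1) u(2) v(1)]
      by (simp add: L_def W_def)
    finally show "W * M = L * W" .
  next
    assume eq: "W * M = L * W"
    have "diag_conj N W m = L * W * mat_adjoint W"
      by (simp add: diag_conj_def eq flip: M_def)
    also have "\<dots> = L"
      using assoc_mult_mat[OF LM(1) w(1) w(2)] right_mult_one_mat[OF LM(1)] w(4) by simp
    finally have "diag_conj N V m = U * L * mat_adjoint U"
      using diag_conj_mult[OF U w(1), of m] by (simp add: V_eq)
    then show "diag_conj N U l = diag_conj N V m"
      by (simp add: diag_conj_def L_def)
  qed
  also have "\<dots> \<longleftrightarrow> (\<forall>i<N. \<forall>j<N. W $$ (i, j) * of_real (m j) = of_real (l i) * W $$ (i, j))"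
    unfolding L_def M_def mat_diag_mult_right[OF w(1)] mat_diag_mult_left[OF w(1)]
    by (auto simp: mat_eq_iff)
  also have "\<dots> \<longleftrightarrow> (\<forall>i<N. \<forall>j<N. W $$ (i, j) \<noteq> 0 \<longrightarrow> l i = m j)"
    by (metis mult.commute mult_cancel_left of_real_eq_iff)
  finally show ?thesis by (simp add: W_def)
qed

text \<open>The definite description is well defined: if nonzero overlaps only connect equal
  eigenvalues, they also only connect equal values of \<open>f\<close>.\<close>

lemma spectral_apply_diag_conj:
  assumes U: "unitary_mat N U"
  shows "spectral_apply f (diag_conj N U d) = diag_conj N U (\<lambda>i. f (d i))"
proof -
  have dim: "dim_row (diag_conj N U d) = N"
    using diag_conj_carrier[OF unitary_matD(1)[OF U], of d] by auto
  show ?thesis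
    unfolding spectral_apply_def dim diag_conj_def[symmetric]
  proof (rule the_equality)
    fix B assume "\<exists>V e. unitary_mat N V \<and> diag_conj N U d = diag_conj N V e
      \<and> B = diag_conj N V (\<lambda>i. f (e i))"
    then obtain V e where V: "unitary_mat N V" "diag_conj N U d = diag_conj N V e"
      "B = diag_conj N V (\<lambda>i. f (e i))" by blast
    then have "diag_conj N U (\<lambda>i. f (d i)) = diag_conj N V (\<lambda>i. f (e i))"
      unfolding diag_conj_eq_iff[OF U V(1)] by metis
    with V show "B = diag_conj N U (\<lambda>i. f (d i))" by simp
  qed (use U in blast)
qed

lemma spectral_apply_Herm: "A \<in> Herm N \<Longrightarrow> spectral_apply f A \<in> Herm N"
  by (metis Herm_diagonalize spectral_apply_diag_conj diag_conj_Herm unitary_matD(1))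

section \<open>Traces and the inner product in terms of eigenvalues\<close>

lemma mat_trace_mult_commute:
  assumes A: "A \<in> carrier_mat m n" and B: "B \<in> carrier_mat n m"
  shows "mat_trace (A * B) = mat_trace (B * A)"
proof -
  have "mat_trace (A * B) = (\<Sum>i<m. \<Sum>k<n. A $$ (i, k) * B $$ (k, i))"
    using A B unfolding mat_trace_def
    by (intro sum.cong) (auto simp: index_mult_mat_sum[OF A B] simp del: index_mult_mat(1))
  also have "\<dots> = (\<Sum>k<n. \<Sum>i<m. B $$ (k, i) * A $$ (i, k))"
    by (subst sum.swap) (simp add: mult.commute)
  also have "\<dots> = mat_trace (B * A)"
    using A B unfolding mat_trace_def
    by (intro sum.cong) (auto simp: index_mult_mat_sum[OF B A] simp del: index_mult_mat(1))
  finally show ?thesis .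
qed

lemma mat_trace_add:
  "A \<in> carrier_mat N N \<Longrightarrow> B \<in> carrier_mat N N \<Longrightarrow> mat_trace (A + B) = mat_trace A + mat_trace B"
  by (simp add: mat_trace_def sum.distrib)

lemma mat_trace_minus:
  "A \<in> carrier_mat N N \<Longrightarrow> B \<in> carrier_mat N N \<Longrightarrow> mat_trace (A - B) = mat_trace A - mat_trace B"
  by (simp add: mat_trace_def sum_subtractf)

lemma herm_inner_commute:
  "A \<in> carrier_mat N N \<Longrightarrow> B \<in> carrier_mat N N \<Longrightarrow> herm_inner A B = herm_inner B A"
  by (simp add: herm_inner_def mat_trace_mult_commute[of A N N B])

lemma herm_inner_add_left:
  assumes "A \<in> carrier_mat N N" "B \<in> carrier_mat N N" "C \<in> carrier_mat N N"
  shows "herm_inner (A + B) C = herm_inner A C + herm_inner B C"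
  using assms by (simp add: herm_inner_def add_mult_distrib_mat[of A N N B C N] mat_trace_add[of _ N])

lemma herm_inner_diff_right:
  assumes "A \<in> carrier_mat N N" "B \<in> carrier_mat N N" "C \<in> carrier_mat N N"
  shows "herm_inner A (B - C) = herm_inner A B - herm_inner A C"
  using assms by (simp add: herm_inner_def mult_minus_distrib_mat[of A N N B N C] mat_trace_minus[of _ N])

text \<open>The squared overlaps of the two eigenbases act as nonnegative weights on pairs of
  eigenvalues. This is what turns trace inequalities for noncommuting matrices into scalar
  ones.\<close>

lemma herm_inner_diag_conj:
  assumes U: "unitary_mat N U" and V: "unitary_mat N V"
  shows "herm_inner (diag_conj N U f) (diag_conj N V g) =
    (\<Sum>i<N. \<Sum>j<N. (cmod ((mat_adjoint U * V) $$ (i, j)))\<^sup>2 * (f i * g j))"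
proof -
  note u = unitary_matD[OF U] and v = unitary_matD[OF V]
  define W where "W = mat_adjoint U * V"
  have W: "W \<in> carrier_mat N N" unfolding W_def using mult_carrier_mat[OF u(2) v(1)] .
  have V_eq: "V = U * W" unfolding W_def using unitary_cancel(1)[OF U v(1)] by simp
  define F where "F = mat_diag N (\<lambda>i. complex_of_real (f i))"
  have F: "F \<in> carrier_mat N N" by (simp add: F_def)
  define E where "E = diag_conj N W g"
  have E: "E \<in> carrier_mat N N" using W by (simp add: E_def)
  have EU: "E * mat_adjoint U \<in> carrier_mat N N" using E u by simp
  have FEU: "F * (E * mat_adjoint U) \<in> carrier_mat N N" using EU F by simp
  have A: "diag_conj N U f \<in> carrier_mat N N" using u by simp
  have B_eq: "diag_conj N V g = U * (E * mat_adjoint U)"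
    using diag_conj_mult[OF U W, of g] assoc_mult_mat[OF u(1) E u(2)] by (simp add: V_eq E_def)
  have "diag_conj N U f * diag_conj N V g = diag_conj N U f * U * (E * mat_adjoint U)"
    unfolding B_eq using assoc_mult_mat[OF A u(1) EU] by simp
  also have "\<dots> = U * (F * (E * mat_adjoint U))"
    using diag_conj_intertwine(1)[OF U, of f] assoc_mult_mat[OF u(1) F EU] by (simp add: F_def)
  \<comment> \<open>Cyclicity moves the outer \<open>U\<close> to the end, where it cancels against
    its adjoint.\<close>
  finally have "mat_trace (diag_conj N U f * diag_conj N V g) =
      mat_trace (F * (E * mat_adjoint U) * U)"
    using mat_trace_mult_commute[OF u(1) FEU] by simp
  also have "F * (E * mat_adjoint U) * U = F * E"
    using assoc_mult_mat[OF F EU u(1)] assoc_mult_mat[OF E u(2) u(1)] right_mult_one_mat[OF E] u(3)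
    by simp
  also have "mat_trace (F * E) = (\<Sum>i<N. of_real (f i) * E $$ (i, i))"
    unfolding F_def mat_diag_mult_left[OF E] by (simp add: mat_trace_def)
  also have "\<dots> = (\<Sum>i<N. of_real (\<Sum>j<N. (cmod (W $$ (i, j)))\<^sup>2 * (f i * g j)))"
    unfolding of_real_sum E_def
    by (intro sum.cong refl) (auto simp: index_diag_conj[OF W] sum_distrib_left complex_norm_square
        simp del: of_real_power intro!: sum.cong)
  finally show ?thesis by (simp add: herm_inner_def W_def flip: of_real_sum)
qed

text \<open>Pairing with the identity, written in the other eigenbasis, gives single traces the same
  weights as inner products, so that all of them can be merged into one double sum.\<close>

lemma Re_mat_trace_diag_conj:
  assumes U: "unitary_mat N U" and V: "unitary_mat N V"
  shows "Re (mat_trace (diag_conj N V g)) =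
      (\<Sum>i<N. \<Sum>j<N. (cmod ((mat_adjoint U * V) $$ (i, j)))\<^sup>2 * g j)"
    "Re (mat_trace (diag_conj N U f)) =
      (\<Sum>i<N. \<Sum>j<N. (cmod ((mat_adjoint U * V) $$ (i, j)))\<^sup>2 * f i)"
  using herm_inner_diag_conj[OF U V, of "\<lambda>_. 1" g] herm_inner_diag_conj[OF U V, of f "\<lambda>_. 1"]
    diag_conj_carrier[OF unitary_matD(1)[OF U], of f] diag_conj_carrier[OF unitary_matD(1)[OF V], of g]
    diag_conj_one[OF U] diag_conj_one[OF V]
  by (simp_all add: herm_inner_def)

section \<open>Positivity, determinant and logarithm from the spectrum\<close>

text \<open>The inner sums are the coordinates of \<open>v\<close> in the eigenbasis.\<close>

lemma diag_conj_quadratic_form: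
  assumes U: "U \<in> carrier_mat N N" and v: "v \<in> carrier_vec N"
  shows "(diag_conj N U d *\<^sub>v v) \<bullet>c v =
    of_real (\<Sum>k<N. d k * (cmod (\<Sum>i<N. cnj (U $$ (i, k)) * v $ i))\<^sup>2)"
proof -
  define z where "z k = (\<Sum>i<N. cnj (U $$ (i, k)) * v $ i)" for k
  have "(diag_conj N U d *\<^sub>v v) $ i = (\<Sum>k<N. U $$ (i, k) * of_real (d k) * z k)" if i: "i < N" for i
  proof -
    have "(diag_conj N U d *\<^sub>v v) $ i = (\<Sum>j<N. diag_conj N U d $$ (i, j) * v $ j)"
      using i v diag_conj_carrier[OF U, of d]
      by (auto simp: scalar_prod_def atLeast0LessThan intro!: sum.cong)
    also have "\<dots> = (\<Sum>j<N. \<Sum>k<N. U $$ (i, k) * of_real (d k) * (cnj (U $$ (j, k)) * v $ j))"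
      using i by (intro sum.cong) (auto simp: index_diag_conj[OF U] sum_distrib_right mult.assoc)
    finally show ?thesis by (subst (asm) sum.swap) (simp add: z_def sum_distrib_left)
  qed
  then have "(diag_conj N U d *\<^sub>v v) \<bullet>c v =
      (\<Sum>i<N. (\<Sum>k<N. U $$ (i, k) * of_real (d k) * z k) * cnj (v $ i))"
    using v diag_conj_carrier[OF U, of d]
    by (auto simp: scalar_prod_def atLeast0LessThan intro!: sum.cong)
  also have "\<dots> = (\<Sum>k<N. \<Sum>i<N. of_real (d k) * z k * (U $$ (i, k) * cnj (v $ i)))"
    by (subst sum.swap) (simp add: sum_distrib_left sum_distrib_right mult_ac)
  also have "\<dots> = (\<Sum>k<N. of_real (d k) * (z k * cnj (z k)))"
    by (simp add: z_def sum_distrib_left mult_ac)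
  finally show ?thesis by (simp add: z_def complex_norm_square del: of_real_power)
qed

lemma pos_semidef_diag_conj_iff:
  assumes U: "unitary_mat N U"
  shows "pos_semidef (diag_conj N U d) \<longleftrightarrow> (\<forall>i<N. 0 \<le> d i)"
proof -
  note u = unitary_matD[OF U]
  have dim: "dim_row (diag_conj N U d) = N" using diag_conj_carrier[OF u(1), of d] by auto
  show ?thesis
  proof
    assume psd: "pos_semidef (diag_conj N U d)"
    show "\<forall>i<N. 0 \<le> d i"
    proof (intro allI impI)
      fix j assume j: "j < N"
      \<comment> \<open>The test vector is the eigenvector of \<open>d j\<close>, whose coordinates
        in the eigenbasis form a standard unit vector.\<close>
      have v: "col U j \<in> carrier_vec N" using col_carrier_vec[OF j u(1)] .
      have "(\<Sum>i<N. cnj (U $$ (i, k)) * col U j $ i) = (if k = j then 1 else 0)" if k: "k < N" for k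
      proof -
        have "(\<Sum>i<N. cnj (U $$ (i, k)) * col U j $ i) = (mat_adjoint U * U) $$ (k, j)"
          using u(1) j k by (subst index_mult_mat_sum[OF u(2) u(1)]) (auto intro!: sum.cong)
        then show ?thesis using j k by (simp add: u)
      qed
      then have "(\<Sum>k<N. d k * (cmod (\<Sum>i<N. cnj (U $$ (i, k)) * col U j $ i))\<^sup>2) =
          (\<Sum>k<N. if k = j then d k else 0)"
        by (intro sum.cong) auto
      also have "\<dots> = d j" using j by simp
      finally show "0 \<le> d j"
        using psd v diag_conj_quadratic_form[OF u(1) v, of d] by (auto simp: pos_semidef_def dim)
    qed
  next
    assume "\<forall>i<N. 0 \<le> d i"
    then show "pos_semidef (diag_conj N U d)"
      unfolding pos_semidef_def dim using diag_conj_Herm[OF u(1), of d]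
      by (auto simp: diag_conj_quadratic_form[OF u(1)] intro!: sum_nonneg)
  qed
qed

lemma det_diag_conj:
  assumes U: "unitary_mat N U"
  shows "det (diag_conj N U d) = of_real (\<Prod>i<N. d i)"
proof -
  note u = unitary_matD[OF U]
  define D where "D = mat_diag N (\<lambda>i. complex_of_real (d i))"
  have D: "D \<in> carrier_mat N N" by (simp add: D_def)
  have "upper_triangular D" by (auto simp: D_def mat_diag_def)
  then have "det D = (\<Prod>i<N. complex_of_real (d i))"
    using det_upper_triangular[OF _ D] D
    by (simp add: prod_list_diag_prod atLeast0LessThan)
      (auto simp: D_def mat_diag_def intro!: prod.cong)
  moreover have "det U * det (mat_adjoint U) = 1"
    using det_mult[OF u(1) u(2)] u(4) by simp
  moreover have "det (diag_conj N U d) = det U * det D * det (mat_adjoint U)"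
    using det_mult[of "U * D" N "mat_adjoint U"] det_mult[OF u(1) D] u D
    by (simp add: diag_conj_def D_def)
  ultimately show ?thesis by (simp add: mult_ac)
qed

text \<open>Positive definiteness is expressed throughout as \<open>pos_semidef\<close> with nonzero
  determinant; the determinant is the product of the eigenvalues, so none of these nonnegative
  numbers is zero.\<close>

lemma pos_semidef_det_diagonalize:
  assumes "A \<in> Herm N" "pos_semidef A" "det A \<noteq> 0"
  obtains U d where "unitary_mat N U" "A = diag_conj N U d" "\<And>i. i < N \<Longrightarrow> 0 < d i"
proof -
  obtain U d where U: "unitary_mat N U" "A = diag_conj N U d" using Herm_diagonalize[OF assms(1)] by blast
  have "0 < d i" if "i < N" for i
    using assms(2,3) that pos_semidef_diag_conj_iff[OF U(1), of d]
    by (auto simp: U(2) det_diag_conj[OF U(1)] less_le)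
  with U that show ?thesis by blast
qed

text \<open>The witness is the matrix exponential of \<open>K\<close>, formed on the
  eigenvalues.\<close>

lemma exists_mat_ln_eq:
  assumes "K \<in> Herm N"
  obtains A where "A \<in> Herm N" "pos_semidef A" "det A \<noteq> 0" "mat_ln A = K"
proof -
  obtain U d where U: "unitary_mat N U" "K = diag_conj N U d" using Herm_diagonalize[OF assms] by blast
  show ?thesis
    by (rule that[of "diag_conj N U (\<lambda>i. exp (d i))"])
      (use U in \<open>auto simp: diag_conj_Herm unitary_matD pos_semidef_diag_conj_iff det_diag_conj
        mat_ln_def spectral_apply_diag_conj\<close>)
qed

section \<open>Klein's inequality and the minimizer of the free energy\<close>

text \<open>For positive \<open>y\<close>, \<open>t\<close> is \<open>y * (z - 1 - ln z)\<close>
  with \<open>z = x / y\<close>. For \<open>y = 0\<close> it equals \<open>x\<close>, which is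
  positive, and both sides of the equivalence are false.\<close>

lemma klein_scalar:
  fixes x y :: real
  assumes "0 < x" "0 \<le> y"
  defines "t \<equiv> (if y = 0 then 0 else y * ln y) - y - ln x * y + x"
  shows "0 \<le> t" "t = 0 \<longleftrightarrow> x = y"
proof -
  have "0 \<le> t \<and> (t = 0 \<longleftrightarrow> x = y)"
  proof (cases "y = 0")
    case True
    then show ?thesis using assms by (auto simp: t_def)
  next
    case False
    then have y: "0 < y" using assms by simp
    have t: "t = y * (x / y - 1 - ln (x / y))"
      using y assms by (simp add: t_def ln_div field_simps)
    have "ln (x / y) \<le> x / y - 1" using y assms by (intro ln_le_minus_one) simp
    moreover have "ln (x / y) = x / y - 1 \<longleftrightarrow> x / y = 1"
      using y assms ln_eq_minus_one[of "x / y"] by auto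
    ultimately show ?thesis using y by (auto simp: t)
  qed
  then show "0 \<le> t" "t = 0 \<longleftrightarrow> x = y" by auto
qed

definition free_energy :: "complex mat \<Rightarrow> complex mat \<Rightarrow> real" where
  "free_energy K B = Re (mat_trace (mat_xlnx B)) - Re (mat_trace B) - herm_inner K B"

text \<open>The gap between the two sides is a double sum of squared overlaps times the scalar gaps
  of \<open>klein_scalar\<close>. It vanishes iff every nonzero overlap connects equal eigenvalues,
  which is the criterion \<open>diag_conj_eq_iff\<close> for \<open>A = B\<close>.\<close>

theorem klein_inequality:
  assumes A: "A \<in> Herm N" "pos_semidef A" "det A \<noteq> 0" and B: "B \<in> Herm N" "pos_semidef B"
  shows "- Re (mat_trace A) \<le> free_energy (mat_ln A) B"
    and "free_energy (mat_ln A) B = - Re (mat_trace A) \<longleftrightarrow> A = B"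
proof -
  obtain U l where U: "unitary_mat N U" and Ae: "A = diag_conj N U l" and l: "\<And>i. i < N \<Longrightarrow> 0 < l i"
    using pos_semidef_det_diagonalize[OF A] by blast
  obtain V m where V: "unitary_mat N V" and Be: "B = diag_conj N V m"
    using Herm_diagonalize[OF B(1)] by blast
  have m: "\<And>i. i < N \<Longrightarrow> 0 \<le> m i" using B pos_semidef_diag_conj_iff[OF V] by (simp add: Be)
  define w where "w i j = (cmod ((mat_adjoint U * V) $$ (i, j)))\<^sup>2" for i j
  define t where "t i j = (if m j = 0 then 0 else m j * ln (m j)) - m j - ln (l i) * m j + l i" for i j
  have "free_energy (mat_ln A) B + Re (mat_trace A) = (\<Sum>i<N. \<Sum>j<N. w i j * t i j)"
    unfolding free_energy_def mat_ln_def mat_xlnx_def Ae Be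
      spectral_apply_diag_conj[OF U] spectral_apply_diag_conj[OF V]
      herm_inner_diag_conj[OF U V] Re_mat_trace_diag_conj(1)[OF U V] Re_mat_trace_diag_conj(2)[OF U V]
    by (simp only: w_def t_def sum.distrib sum_subtractf ring_distribs)
  moreover have nonneg: "0 \<le> w i j * t i j" if "i < N" "j < N" for i j
    using klein_scalar(1)[OF l m] that by (simp add: w_def t_def)
  then have "0 \<le> (\<Sum>i<N. \<Sum>j<N. w i j * t i j)" by (intro sum_nonneg) auto
  moreover have "(\<Sum>i<N. \<Sum>j<N. w i j * t i j) = 0 \<longleftrightarrow> A = B"
  proof -
    have "(\<Sum>i<N. \<Sum>j<N. w i j * t i j) = 0 \<longleftrightarrow> (\<forall>i<N. (\<Sum>j<N. w i j * t i j) = 0)"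
      using nonneg by (subst sum_nonneg_eq_0_iff) (auto intro!: sum_nonneg)
    also have "\<dots> \<longleftrightarrow> (\<forall>i<N. \<forall>j<N. w i j * t i j = 0)"
      by (intro all_cong imp_cong refl, subst sum_nonneg_eq_0_iff) (use nonneg in auto)
    also have "\<dots> \<longleftrightarrow> (\<forall>i<N. \<forall>j<N. (mat_adjoint U * V) $$ (i, j) \<noteq> 0 \<longrightarrow> l i = m j)"
      using klein_scalar(2)[OF l m] by (auto simp: w_def t_def)
    finally show ?thesis unfolding Ae Be diag_conj_eq_iff[OF U V] .
  qed
  ultimately show "- Re (mat_trace A) \<le> free_energy (mat_ln A) B"
    "free_energy (mat_ln A) B = - Re (mat_trace A) \<longleftrightarrow> A = B" by linarith+
qed

text \<open>The lower bound is attained at \<open>A\<close> itself, so a minimizer must attain it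
  too, and the equality case identifies it.\<close>

lemma minimizes_free_energy_iff:
  assumes A: "A \<in> Herm N" "pos_semidef A" "det A \<noteq> 0" and B: "B \<in> Herm N" "pos_semidef B"
  shows "(\<forall>C\<in>Herm N. pos_semidef C \<longrightarrow> free_energy (mat_ln A) B \<le> free_energy (mat_ln A) C) \<longleftrightarrow> A = B"
proof
  assume "\<forall>C\<in>Herm N. pos_semidef C \<longrightarrow> free_energy (mat_ln A) B \<le> free_energy (mat_ln A) C"
  then have "free_energy (mat_ln A) B \<le> free_energy (mat_ln A) A" using A by blast
  then show "A = B"
    using klein_inequality[OF A B] klein_inequality(2)[OF A A(1,2)] by auto
next
  assume "A = B"
  then show "\<forall>C\<in>Herm N. pos_semidef C \<longrightarrow> free_energy (mat_ln A) B \<le> free_energy (mat_ln A) C"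
    using klein_inequality(1)[OF A] klein_inequality(2)[OF A B] by auto
qed

section \<open>Subgradients of the relative entropy\<close>

lemma QKL_eq_free_energy:
  assumes "\<sigma> \<in> Herm N" "\<rho>\<^sub>0 \<in> Herm N" "pos_semidef \<sigma>"
  shows "QKL \<sigma> \<rho>\<^sub>0 = ereal (Re (mat_trace \<rho>\<^sub>0) + free_energy (mat_ln \<rho>\<^sub>0) \<sigma>)"
proof -
  have X: "mat_xlnx \<sigma> \<in> carrier_mat N N" and L: "mat_ln \<rho>\<^sub>0 \<in> carrier_mat N N"
    using assms HermD(1)[OF spectral_apply_Herm] by (auto simp: mat_xlnx_def mat_ln_def)
  note c = HermD(1)[OF assms(1)] HermD(1)[OF assms(2)]
  have "\<rho>\<^sub>0 - \<sigma> \<in> carrier_mat N N" "\<sigma> * mat_ln \<rho>\<^sub>0 \<in> carrier_mat N N"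
    "\<rho>\<^sub>0 - \<sigma> + mat_xlnx \<sigma> \<in> carrier_mat N N"
    using c X L by (auto simp: minus_carrier_mat)
  then show ?thesis
    using assms(3) c X L herm_inner_commute[OF L c(1)]
    by (simp add: QKL_def free_energy_def herm_inner_def mat_trace_minus[of _ N] mat_trace_add[of _ N])
qed

text \<open>Where \<sigma> is not positive semidefinite the right side is infinite and nothing is
  demanded. Elsewhere the constant trace of \<open>\<rho>\<^sub>0\<close> cancels, and the linear
  term of \<open>s\<close> joins that of \<open>mat_ln \<rho>\<^sub>0\<close>.\<close>

lemma mem_subdifferential_QKL_iff:
  assumes \<rho>0: "\<rho>\<^sub>0 \<in> Herm N" and \<rho>: "\<rho> \<in> Herm N" "pos_semidef \<rho>"
  shows "s \<in> subdifferential (Herm N) herm_inner (\<lambda>\<sigma>. QKL \<sigma> \<rho>\<^sub>0) \<rho> \<longleftrightarrow> s \<in> Herm N \<and>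
    (\<forall>\<sigma>\<in>Herm N. pos_semidef \<sigma> \<longrightarrow>
      free_energy (s + mat_ln \<rho>\<^sub>0) \<rho> \<le> free_energy (s + mat_ln \<rho>\<^sub>0) \<sigma>)"
proof -
  have L: "mat_ln \<rho>\<^sub>0 \<in> Herm N" using spectral_apply_Herm[OF \<rho>0] by (simp add: mat_ln_def)
  have "QKL \<rho> \<rho>\<^sub>0 + ereal (herm_inner s (\<sigma> - \<rho>)) \<le> QKL \<sigma> \<rho>\<^sub>0 \<longleftrightarrow>
      (pos_semidef \<sigma> \<longrightarrow> free_energy (s + mat_ln \<rho>\<^sub>0) \<rho> \<le> free_energy (s + mat_ln \<rho>\<^sub>0) \<sigma>)"
    if s: "s \<in> Herm N" and \<sigma>: "\<sigma> \<in> Herm N" for \<sigma>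
  proof (cases "pos_semidef \<sigma>")
    case True
    note c = HermD(1)[OF s] HermD(1)[OF L] HermD(1)[OF \<rho>(1)] HermD(1)[OF \<sigma>]
    show ?thesis
      using True c herm_inner_diff_right[OF c(1,4,3)]
        herm_inner_add_left[OF c(1,2,3)] herm_inner_add_left[OF c(1,2,4)]
      by (auto simp: QKL_eq_free_energy[OF \<rho>(1) \<rho>0 \<rho>(2)] QKL_eq_free_energy[OF \<sigma> \<rho>0]
          free_energy_def)
  qed (simp add: QKL_def)
  then show ?thesis by (auto simp: subdifferential_def)
qed

lemma mat_kernel_trivial_iff_det:
  fixes A :: "'a :: field mat"
  assumes A: "A \<in> carrier_mat n n"
  shows "mat_kernel A = {0\<^sub>v n} \<longleftrightarrow> det A \<noteq> 0"
proof -
  have "A *\<^sub>v 0\<^sub>v n = 0\<^sub>v n" using A by (intro eq_vecI) (auto simp: scalar_prod_def)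
  then show ?thesis
    using det_0_iff_vec_prod_zero_field[OF A] by (auto simp: mat_kernel[OF A])
qed

theorem lemma3p1:
  fixes N :: nat and \<rho>\<^sub>0 \<rho> :: "complex mat"
  assumes "\<rho>\<^sub>0 \<in> Herm N"
    and "pos_semidef \<rho>\<^sub>0"
    and "vec_space.rank N \<rho>\<^sub>0 = N"
    and "\<rho> \<in> essential_domain (Herm N) (\<lambda>\<sigma>. QKL \<sigma> \<rho>\<^sub>0)"
  shows "subdifferential (Herm N) herm_inner (\<lambda>\<sigma>. QKL \<sigma> \<rho>\<^sub>0) \<rho> =
    (if mat_kernel \<rho> = {0\<^sub>v N} then {mat_ln \<rho> - mat_ln \<rho>\<^sub>0} else {})"
proof -
  \<comment> \<open>A finite value rules out the infinite branch of \<open>QKL\<close>.\<close>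
  have \<rho>: "\<rho> \<in> Herm N" "pos_semidef \<rho>"
    using assms(4) by (auto simp: essential_domain_def QKL_def split: if_splits)
  have ln_Herm: "mat_ln A \<in> Herm N" if "A \<in> Herm N" for A
    using spectral_apply_Herm[OF that] by (simp add: mat_ln_def)
  note L = ln_Herm[OF assms(1)] ln_Herm[OF \<rho>(1)]
  have sub: "s \<in> subdifferential (Herm N) herm_inner (\<lambda>\<sigma>. QKL \<sigma> \<rho>\<^sub>0) \<rho> \<longleftrightarrow>
      det \<rho> \<noteq> 0 \<and> s = mat_ln \<rho> - mat_ln \<rho>\<^sub>0" for s
  proof
    assume "s \<in> subdifferential (Herm N) herm_inner (\<lambda>\<sigma>. QKL \<sigma> \<rho>\<^sub>0) \<rho>"
    then have s: "s \<in> Herm N" and min: "\<forall>\<sigma>\<in>Herm N. pos_semidef \<sigma> \<longrightarrow>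
        free_energy (s + mat_ln \<rho>\<^sub>0) \<rho> \<le> free_energy (s + mat_ln \<rho>\<^sub>0) \<sigma>"
      using mem_subdifferential_QKL_iff[OF assms(1) \<rho>] by auto
    \<comment> \<open>\<open>A\<close> is the exponential of
      \<open>s + mat_ln \<rho>\<^sub>0\<close>, the unique minimizer of the free energy that \<rho>
      minimizes as well. Invertibility of \<rho> is thus inherited from \<open>A\<close>.\<close>
    obtain A where A: "A \<in> Herm N" "pos_semidef A" "det A \<noteq> 0" "mat_ln A = s + mat_ln \<rho>\<^sub>0"
      using exists_mat_ln_eq[OF Herm_add[OF s L(1)]] by blast
    then have "A = \<rho>" using min minimizes_free_energy_iff[OF A(1-3) \<rho>] by simp
    moreover have "s + mat_ln \<rho>\<^sub>0 - mat_ln \<rho>\<^sub>0 = s"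
      using HermD(1)[OF s] HermD(1)[OF L(1)] by (intro eq_matI) auto
    ultimately show "det \<rho> \<noteq> 0 \<and> s = mat_ln \<rho> - mat_ln \<rho>\<^sub>0" using A by simp
  next
    assume s: "det \<rho> \<noteq> 0 \<and> s = mat_ln \<rho> - mat_ln \<rho>\<^sub>0"
    then have "s + mat_ln \<rho>\<^sub>0 = mat_ln \<rho>"
      using HermD(1)[OF L(2)] HermD(1)[OF L(1)] by auto
    then show "s \<in> subdifferential (Herm N) herm_inner (\<lambda>\<sigma>. QKL \<sigma> \<rho>\<^sub>0) \<rho>"
      using s minimizes_free_energy_iff[OF \<rho> _ \<rho>] Herm_minus[OF L(2,1)]
      by (simp add: mem_subdifferential_QKL_iff[OF assms(1) \<rho>])
  qed
  then show ?thesis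
    using mat_kernel_trivial_iff_det[OF HermD(1)[OF \<rho>(1)]] by auto
qed

end
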